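(* Let $n\ge 1$ and let $p\in \mathrm{Hom}_{+}(n,n)$ be H-Stable. Then $$\frac{\partial^n}{\partial x_1\cdots\partial x_n}p(0,\dots,0)\;\ge\;\prod_{2\le i\le n} G\big(\min(i,\deg_p(i))\big)\,\mathrm{Cap}(p).$$
   Context: $\mathrm{Hom}_{+}(m,n)$ denotes the set of homogeneous polynomials of degree $n$ in $m$ variables with real nonnegative coefficients; $\mathrm{Hom}_{C}(m,n)$ the homogeneous polynomials of degree $n$ in $m$ variables with complex coefficients. A polynomial $p\in\mathrm{Hom}_C(m,n)$ is called H-Stable if $p(z_1,\dots,z_m)\neq 0$ whenever $\mathrm{Re}(z_i)>0$ for all $i$. For $p\in \mathrm{Hom}_+(n,n)$, $\mathrm{Cap}(p)=\inf_{x\in\mathbb{R}^n,\,x_i>0}\frac{p(x_1,\dots,x_n)}{x_1\cdots x_n}$. $\deg_p(i)$ is the maximal exponent of $x_i$ over all monomials of $p$ with nonzero coefficient. $G(1)=1$ and $G(m)=\left(\frac{m-1}{m}\right)^{m-1}$ for integers $m\ge 2$; we use the convention $G(0)=1$. *)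

theory Defs
  imports "HOL-Analysis.Analysis" "HOL-Library.Poly_Mapping"
begin

text \<open>
  A monomial maps each variable index to its exponent, and a polynomial maps each monomial to
  its coefficient. Polynomials in \<open>m\<close> variables use the indices \<open>1, \<dots>, m\<close>.
  Points of the \<open>m\<close>-dimensional space are functions on \<open>nat\<close>, of which only the
  values at \<open>1, \<dots>, m\<close> matter.
\<close>

type_synonym 'a mvpoly = "(nat \<Rightarrow>\<^sub>0 nat) \<Rightarrow>\<^sub>0 'a"

definition mveval :: "'a::comm_semiring_1 mvpoly \<Rightarrow> (nat \<Rightarrow> 'a) \<Rightarrow> 'a" where
  "mveval p x = (\<Sum>a\<in>Poly_Mapping.keys p.
     Poly_Mapping.lookup p a * (\<Prod>i\<in>Poly_Mapping.keys a. x i ^ Poly_Mapping.lookup a i))"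

text \<open>As usual, the zero polynomial counts as homogeneous of every degree.\<close>

definition Hom :: "nat \<Rightarrow> nat \<Rightarrow> 'a::zero mvpoly set" where
  "Hom m n = {p. \<forall>a\<in>Poly_Mapping.keys p.
     Poly_Mapping.keys a \<subseteq> {1..m} \<and> (\<Sum>i\<in>{1..m}. Poly_Mapping.lookup a i) = n}"

definition Hom_plus :: "nat \<Rightarrow> nat \<Rightarrow> real mvpoly set" where
  "Hom_plus m n = {p \<in> Hom m n. \<forall>a. 0 \<le> Poly_Mapping.lookup p a}"

abbreviation Hom_C :: "nat \<Rightarrow> nat \<Rightarrow> complex mvpoly set" where
  "Hom_C \<equiv> Hom"

definition H_stable :: "nat \<Rightarrow> nat \<Rightarrow> complex mvpoly \<Rightarrow> bool" where
  "H_stable m n p \<longleftrightarrow> p \<in> Hom_C m n \<and>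
     (\<forall>z. (\<forall>i\<in>{1..m}. 0 < Re (z i)) \<longrightarrow> mveval p z \<noteq> 0)"

abbreviation complexify :: "real mvpoly \<Rightarrow> complex mvpoly" where
  "complexify \<equiv> Poly_Mapping.map complex_of_real"

definition Cap :: "nat \<Rightarrow> real mvpoly \<Rightarrow> real" where
  "Cap n p = (INF x\<in>{x. \<forall>i\<in>{1..n}. 0 < x i}. mveval p x / (\<Prod>i\<in>{1..n}. x i))"

text \<open>The \<open>0\<close> only serves to give the zero polynomial a degree.\<close>

definition deg_var :: "'a::zero mvpoly \<Rightarrow> nat \<Rightarrow> nat" where
  "deg_var p i = Max (insert 0 ((\<lambda>a. Poly_Mapping.lookup a i) ` Poly_Mapping.keys p))"

definition G :: "nat \<Rightarrow> real" where
  "G m = (if m \<le> 1 then 1 else ((real m - 1) / real m) ^ (m - 1))"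

definition partial_deriv :: "nat \<Rightarrow> ((nat \<Rightarrow> real) \<Rightarrow> real) \<Rightarrow> (nat \<Rightarrow> real) \<Rightarrow> real" where
  "partial_deriv i f x = deriv (\<lambda>t. f (x(i := t))) (x i)"

text \<open>The innermost derivative is the one in variable \<open>n\<close>, the outermost the one in variable \<open>1\<close>.\<close>

definition mixed_partial :: "nat \<Rightarrow> ((nat \<Rightarrow> real) \<Rightarrow> real) \<Rightarrow> (nat \<Rightarrow> real) \<Rightarrow> real" where
  "mixed_partial n f = foldr partial_deriv [1..<Suc n] f"

end

theory Submission
  imports Defs "HOL-Computational_Algebra.Fundamental_Theorem_Algebra"
    "HOL-Complex_Analysis.Complex_Analysis"
begin

text \<open>
  Let \<open>q\<^sub>i(x\<^sub>1, \<dots>, x\<^sub>i)\<close> be the derivative of \<open>p\<close> in \<open>x\<^bsub>i+1\<^esub>, \<dots>, x\<^sub>n\<close> evaluated where these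
  variables are \<open>0\<close>; it is homogeneous of degree \<open>i\<close>, and \<open>q\<^bsub>i-1\<^esub>\<close> is the linear coefficient of
  \<open>q\<^sub>i\<close> in \<open>x\<^sub>i\<close>. By Hurwitz's theorem each \<open>q\<^sub>i\<close> is H-stable or zero. For positive
  \<open>x\<^sub>1, \<dots>, x\<^bsub>i-1\<^esub>\<close>, stability and homogeneity force the roots of \<open>q\<^sub>i\<close> in \<open>x\<^sub>i\<close> to be real and
  nonpositive. A univariate \<open>R\<close> of degree at most \<open>d\<close> with such roots satisfies
  \<open>R(t) \<le> R(0) (1 + R'(0) t / (d R(0)))\<^sup>d\<close> by the AM-GM inequality, and the best choice of \<open>t\<close> gives
  \<open>R'(0) \<ge> G(d) inf R(t) / t\<close>. So the capacity drops at most by the factor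
  \<open>G(min(i, deg\<^sub>p(i)))\<close> from \<open>q\<^sub>i\<close> to \<open>q\<^bsub>i-1\<^esub>\<close>.
\<close>

section \<open>Univariate polynomials and their reciprocal roots\<close>

text \<open>Negated reciprocals of roots allow padding: \<open>b = 0\<close> contributes the factor
  1, so a polynomial of smaller degree still gets exactly \<open>d\<close> factors, as AM-GM with
  exponent \<open>d\<close> requires.\<close>

lemma reciprocal_root_factorization:
  fixes p :: "complex poly"
  assumes "coeff p 0 \<noteq> 0" "degree p \<le> d"
  shows "\<exists>B. size B = d \<and> p = smult (coeff p 0) (\<Prod>b\<in>#B. [:1, b:]) \<and>
           (\<forall>b\<in>#B. b = 0 \<or> poly p (- 1 / b) = 0)"
  using assms
proof (induction d arbitrary: p)
  case 0
  then obtain c where "p = [:c:]"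
    by (auto elim: degree_eq_zeroE)
  then show ?case by (intro exI[of _ "{#}"]) simp
next
  case (Suc d)
  show ?case
  proof (cases "degree p \<le> d")
    case True
    with Suc obtain B where "size B = d" "p = smult (coeff p 0) (\<Prod>b\<in>#B. [:1, b:])"
      "\<forall>b\<in>#B. b = 0 \<or> poly p (- 1 / b) = 0"
      by blast
    then show ?thesis by (intro exI[of _ "add_mset 0 B"]) (simp flip: one_pCons)
  next
    case False
    then have "\<not> constant (poly p)"
      by (simp add: constant_degree)
    then obtain z where z: "poly p z = 0"
      using Fundamental_Theorem_Algebra.fundamental_theorem_of_algebra[of p] by auto
    have z0: "z \<noteq> 0"
      using z Suc.prems(1) by (auto simp: poly_0_coeff_0)
    obtain r where r: "p = [:- z, 1:] * r"
      using z unfolding poly_eq_0_iff_dvd by (rule dvdE)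
    \<comment> \<open>Moving \<open>- z\<close> into \<open>q\<close> gives the linear factor the
      constant term 1, so \<open>q\<close> keeps the constant coefficient of
      \<open>p\<close>.\<close>
    define q where "q = smult (- z) r"
    have pq: "p = [:1, - 1 / z:] * q"
    proof -
      have "[:- z, 1:] = smult (- z) [:1, - 1 / z:]" using z0 by simp
      then show ?thesis unfolding q_def r by (simp only: mult_smult_left mult_smult_right)
    qed
    have c0: "coeff p 0 = coeff q 0"
      by (subst pq) simp
    have "q \<noteq> 0" using c0 Suc.prems by auto
    then have "degree p = Suc (degree q)"
      unfolding pq using z0 by (subst degree_mult_eq) auto
    with Suc.prems c0 have "coeff q 0 \<noteq> 0" "degree q \<le> d" by auto
    from Suc.IH[OF this] obtain B where B: "size B = d"
      "q = smult (coeff q 0) (\<Prod>b\<in>#B. [:1, b:])"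
      "\<forall>b\<in>#B. b = 0 \<or> poly q (- 1 / b) = 0"
      by blast
    have "p = smult (coeff p 0) (\<Prod>b\<in>#add_mset (- 1 / z) B. [:1, b:])"
      unfolding c0 by (subst pq, subst B(2)) (simp add: mult_smult_right del: mult_pCons_left)
    moreover have "\<forall>b\<in>#add_mset (- 1 / z) B. b = 0 \<or> poly p (- 1 / b) = 0"
      using B(3) z z0 by (auto simp: pq)
    ultimately show ?thesis
      using B(1) by (intro exI[of _ "add_mset (- 1 / z) B"]) simp
  qed
qed

lemma poly_map_poly_of_real:
  "poly (map_poly of_real p) (of_real t) = (of_real (poly p t) :: 'a :: {real_algebra_1, comm_ring_1})"
  by (induction p) (auto simp: map_poly_pCons)

lemma coeff_0_prod_mset_linear: "coeff (\<Prod>b\<in>#B. [:1, b:]) 0 = (1 :: 'a :: comm_ring_1)"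
  by (induction B) (auto simp: coeff_mult)

lemma coeff_1_prod_mset_linear: "coeff (\<Prod>b\<in>#B. [:1, b:]) 1 = (\<Sum>b\<in>#B. b :: 'a :: comm_ring_1)"
proof (induction B)
  case (add b B)
  have "coeff (\<Prod>b\<in>#B. [:1, b:]) 0 = (1 :: 'a)"
    by (rule coeff_0_prod_mset_linear)
  with add show ?case by (simp add: algebra_simps)
qed simp

lemma poly_prod_mset_linear:
  "poly (\<Prod>b\<in>#B. [:1, b:]) t = (\<Prod>b\<in>#B. 1 + b * t :: 'a :: comm_ring_1)"
  by (induction B) (auto simp: algebra_simps)

lemma prod_mset_image_nonneg:
  fixes f :: "'b \<Rightarrow> 'a :: linordered_semidom"
  assumes "\<And>b. b \<in># B \<Longrightarrow> 0 \<le> f b"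
  shows "0 \<le> (\<Prod>b\<in>#B. f b)"
  using assms by (induction B) auto

text \<open>The product of the bounds \<open>f b \<le> A exp (f b / A - 1)\<close>; the mean for \<open>A\<close> gives AM-GM.\<close>

lemma prod_mset_le_power_exp:
  fixes f :: "'b \<Rightarrow> real"
  assumes "\<And>b. b \<in># B \<Longrightarrow> 0 \<le> f b" "0 < A"
  shows "(\<Prod>b\<in>#B. f b) \<le> A ^ size B * exp ((\<Sum>b\<in>#B. f b) / A - size B)"
  using assms(1)
proof (induction B)
  case (add b B)
  have "f b / A \<le> exp (f b / A - 1)"
    using exp_ge_add_one_self[of "f b / A - 1"] by simp
  then have "f b \<le> A * exp (f b / A - 1)"
    using assms(2) by (simp add: divide_le_eq mult.commute)
  then have "f b * (\<Prod>b\<in>#B. f b) \<le>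
      (A * exp (f b / A - 1)) * (A ^ size B * exp ((\<Sum>b\<in>#B. f b) / A - size B))"
    using add assms(2) by (intro mult_mono prod_mset_image_nonneg) auto
  also have "\<dots> = A ^ size (add_mset b B) * exp ((\<Sum>b\<in>#add_mset b B. f b) / A - size (add_mset b B))"
    by (simp add: mult_exp_exp add_divide_distrib algebra_simps)
  finally show ?case by simp
qed simp

lemma arith_geo_mean_mset:
  fixes f :: "'b \<Rightarrow> real"
  assumes "\<And>b. b \<in># B \<Longrightarrow> 0 \<le> f b" "B \<noteq> {#}" "0 < (\<Sum>b\<in>#B. f b)"
  shows "(\<Prod>b\<in>#B. f b) \<le> ((\<Sum>b\<in>#B. f b) / size B) ^ size B"
proof -
  have s: "0 < real (size B)" using assms(2) by (simp add: nonempty_has_size)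
  define A where "A = (\<Sum>b\<in>#B. f b) / size B"
  have "0 < A" using assms(3) s by (simp add: A_def)
  have "(\<Sum>b\<in>#B. f b) / A = size B" using assms(3) s by (simp add: A_def)
  moreover have "(\<Prod>b\<in>#B. f b) \<le> A ^ size B * exp ((\<Sum>b\<in>#B. f b) / A - size B)"
    using assms(1) \<open>0 < A\<close> by (rule prod_mset_le_power_exp)
  ultimately have "(\<Prod>b\<in>#B. f b) \<le> A ^ size B"
    by simp
  then show ?thesis by (simp add: A_def)
qed

text \<open>The quotient is the sum of the \<open>b\<close>. For \<open>b \<noteq> 0\<close>,
  \<open>Re (- 1 / b)\<close> has the sign opposite to \<open>Re b\<close>, so roots outside the
  right half-plane give \<open>Re b \<ge> 0\<close>.\<close>

lemma Re_linear_coeff_quotient_nonneg: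
  fixes p :: "complex poly"
  assumes "coeff p 0 \<noteq> 0" "\<And>t. 0 < Re t \<Longrightarrow> poly p t \<noteq> 0"
  shows "0 \<le> Re (coeff p 1 / coeff p 0)"
proof -
  obtain B where B: "p = smult (coeff p 0) (\<Prod>b\<in>#B. [:1, b:])"
    "\<forall>b\<in>#B. b = 0 \<or> poly p (- 1 / b) = 0"
    using reciprocal_root_factorization[OF assms(1) order.refl] by blast
  have "0 \<le> Re b" if "b \<in># B" for b
  proof (cases "b = 0")
    case False
    then have "\<not> 0 < Re (- 1 / b)" using B(2) that assms(2) by blast
    then show ?thesis
      using False by (simp add: Re_divide not_less divide_le_0_iff zero_le_divide_iff)
         (smt (verit) complex_neq_0 zero_le_power2)
  qed simp
  then have "0 \<le> Re (\<Sum>b\<in>#B. b)"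
    by (induction B) auto
  moreover have "coeff p 1 = coeff p 0 * (\<Sum>b\<in>#B. b)"
    using arg_cong[OF B(1), of "\<lambda>p. coeff p 1"] coeff_1_prod_mset_linear[of B] by simp
  ultimately show ?thesis using assms(1) by simp
qed

text \<open>All \<open>b\<close> are real and nonnegative and sum to
  \<open>coeff p 1 / coeff p 0\<close>; AM-GM applies to the \<open>d\<close> factors
  \<open>1 + b * t\<close>.\<close>

lemma real_rooted_le_power:
  fixes p :: "real poly"
  assumes "0 < coeff p 0" "degree p \<le> d" "1 \<le> d" "0 \<le> t"
    and roots: "\<And>z :: complex. poly (map_poly of_real p) z = 0 \<Longrightarrow> z \<in> \<real>\<^sub>\<le>\<^sub>0"
  shows "0 \<le> coeff p 1" "poly p t \<le> coeff p 0 * (1 + coeff p 1 / coeff p 0 * t / d) ^ d"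
proof -
  let ?p = "map_poly complex_of_real p"
  have 0: "coeff ?p 0 \<noteq> 0" "degree ?p \<le> d"
    using assms(1,2) by (auto simp: coeff_map_poly degree_map_poly)
  obtain B where B: "size B = d" "?p = smult (coeff ?p 0) (\<Prod>b\<in>#B. [:1, b:])"
    "\<forall>b\<in>#B. b = 0 \<or> poly ?p (- 1 / b) = 0"
    using reciprocal_root_factorization[OF 0] by blast
  have b: "b = of_real (Re b) \<and> 0 \<le> Re b" if "b \<in># B" for b
  proof (cases "b = 0")
    case False
    then have "- 1 / b \<in> \<real>\<^sub>\<le>\<^sub>0" using B(3) that roots by blast
    then obtain s where s: "s \<le> 0" "- 1 / b = of_real s" by (rule nonpos_Reals_cases)
    then have "b = of_real (- 1 / s)" by (simp flip: s(2))
    then show ?thesis using s(1) by (simp add: divide_nonneg_nonpos)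
  qed simp
  define C where "C = image_mset Re B"
  have C: "size C = d" "B = image_mset of_real C"
    using b B(1) by (auto simp: C_def multiset.map_comp o_def intro!: multiset.map_ident_strong[symmetric])
  have C0: "0 \<le> c" if "c \<in># C" for c using that b by (auto simp: C_def)
  have "coeff ?p 1 = coeff ?p 0 * (\<Sum>b\<in>#B. b)"
    using arg_cong[OF B(2), of "\<lambda>p. coeff p 1"] coeff_1_prod_mset_linear[of B] by simp
  moreover have "(\<Sum>b\<in>#B. b) = of_real (\<Sum>c\<in>#C. c)"
    unfolding C(2) by (induction C) auto
  ultimately have "complex_of_real (coeff p 1) = of_real (coeff p 0 * (\<Sum>c\<in>#C. c))"
    by (simp add: coeff_map_poly)
  then have c1: "coeff p 1 = coeff p 0 * (\<Sum>c\<in>#C. c)" using of_real_eq_iff by blast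
  have "0 \<le> (\<Sum>c\<in>#C. c)" using C0 by (induction C) auto
  then show "0 \<le> coeff p 1" using c1 assms(1) by simp
  have "poly ?p (of_real t) = coeff ?p 0 * (\<Prod>b\<in>#B. 1 + b * of_real t)"
    by (subst B(2)) (simp add: poly_prod_mset_linear)
  moreover have "(\<Prod>b\<in>#B. 1 + b * of_real t) = of_real (\<Prod>c\<in>#C. 1 + c * t)"
    unfolding C(2) by (induction C) auto
  ultimately have "complex_of_real (poly p t) = of_real (coeff p 0 * (\<Prod>c\<in>#C. 1 + c * t))"
    by (simp add: coeff_map_poly poly_map_poly_of_real)
  then have pt: "poly p t = coeff p 0 * (\<Prod>c\<in>#C. 1 + c * t)" using of_real_eq_iff by blast
  have sum: "(\<Sum>c\<in>#C. 1 + c * t) = d + (\<Sum>c\<in>#C. c) * t"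
    unfolding C(1)[symmetric] by (induction C) (auto simp: algebra_simps)
  have "(\<Prod>c\<in>#C. 1 + c * t) \<le> ((d + (\<Sum>c\<in>#C. c) * t) / d) ^ d"
    using arith_geo_mean_mset[of C "\<lambda>c. 1 + c * t"] C0 assms(3,4) \<open>0 \<le> (\<Sum>c\<in>#C. c)\<close> C(1)
    unfolding sum by (force intro: add_pos_nonneg)
  also have "(d + (\<Sum>c\<in>#C. c) * t) / d = 1 + coeff p 1 / coeff p 0 * t / d"
    using c1 assms(1,3) by (simp add: field_simps)
  finally show "poly p t \<le> coeff p 0 * (1 + coeff p 1 / coeff p 0 * t / d) ^ d"
    using assms(1) by (simp add: pt)
qed

lemma G_nonneg: "0 \<le> G m" and G_le_1: "G m \<le> 1"
  by (auto simp: G_def intro!: power_le_one)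

lemma slope_ge_if_linear_bound:
  fixes a b C :: real
  assumes "\<And>t. 0 < t \<Longrightarrow> C * t \<le> a + b * t"
  shows "C \<le> b"
proof (rule ccontr)
  assume "\<not> C \<le> b"
  then have "C - b > 0" by simp
  \<comment> \<open>Chosen so that \<open>(C - b) * t\<close> exceeds \<open>a\<close>.\<close>
  define t where "t = (\<bar>a\<bar> + 1) / (C - b)"
  have "0 < t" "(C - b) * t = \<bar>a\<bar> + 1" using \<open>C - b > 0\<close> by (auto simp: t_def)
  with assms[of t] show False by (auto simp: algebra_simps)
qed

text \<open>The lower bound \<open>C\<close> for \<open>poly p t / t\<close> is compared with the
  AM-GM upper bound at its best \<open>t\<close>. The cases \<open>d \<le> 1\<close>,
  \<open>coeff p 0 = 0\<close> and \<open>coeff p 1 = 0\<close> are handled apart.\<close>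

lemma linear_coeff_ge_G:
  fixes p :: "real poly"
  assumes "degree p \<le> d" "0 \<le> C" "0 \<le> coeff p 0"
    and C: "\<And>t. 0 < t \<Longrightarrow> C * t \<le> poly p t"
    and roots: "\<And>z :: complex. poly (map_poly of_real p) z = 0 \<Longrightarrow> z \<in> \<real>\<^sub>\<le>\<^sub>0"
  shows "G d * C \<le> coeff p 1"
proof (cases "d \<le> 1")
  case True
  have "poly p t = coeff p 0 + coeff p 1 * t" for t
  proof -
    obtain a q where q: "p = pCons a q" by (cases p)
    with True assms(1) have "degree q = 0" by (auto split: if_splits)
    then obtain b where "q = [:b:]" by (auto elim: degree_eq_zeroE)
    then show ?thesis by (simp add: q)
  qed
  with C True show ?thesis by (auto simp: G_def intro: slope_ge_if_linear_bound)
next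
  case False
  then have d: "2 \<le> d" by simp
  consider "coeff p 0 = 0" | "0 < coeff p 0" using assms(3) by linarith
  then show ?thesis
  proof cases
    case 1
    obtain a q where q: "p = pCons a q" by (cases p)
    with 1 have "a = 0" by simp
    \<comment> \<open>Here \<open>poly q t\<close> is \<open>poly p t / t\<close>; letting
      \<open>t\<close> tend to 0 from the right gives \<open>C \<le> coeff p 1\<close>, without the
      loss of \<open>G d\<close>.\<close>
    have "C \<le> poly q t" if "0 < t" for t
      using C[OF that] that by (simp add: q \<open>a = 0\<close> mult.commute)
    moreover have "(poly q \<longlongrightarrow> poly q 0) (at_right 0)"
      by (intro tendsto_intros)
    ultimately have "C \<le> poly q 0"
      by (intro tendsto_lowerbound[where F = "at_right 0"])
         (auto simp: eventually_at_right_less intro: eventually_at_right_less eventually_mono[OF eventually_at_right_less])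
    also have "poly q 0 = coeff p 1" by (simp add: q poly_0_coeff_0)
    finally show ?thesis
      using mult_right_mono[OF G_le_1[of d] assms(2)] by simp
  next
    case 2
    define S where "S = coeff p 1 / coeff p 0"
    have le: "poly p t \<le> coeff p 0 * (1 + S * t / d) ^ d" "0 \<le> coeff p 1" if "0 \<le> t" for t
      using real_rooted_le_power[OF 2 assms(1) _ that roots] d by (auto simp: S_def)
    have S: "0 \<le> S" "coeff p 1 = S * coeff p 0" using le(2)[of 0] 2 by (auto simp: S_def)
    show ?thesis
    proof (cases "S = 0")
      case True
      \<comment> \<open>With \<open>S = 0\<close> the upper bound is constant in \<open>t\<close>,
        so the slope \<open>C\<close> cannot be positive.\<close>
      have "C \<le> 0"
      proof (rule slope_ge_if_linear_bound)
        show "C * t \<le> coeff p 0 + 0 * t" if "0 < t" for t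
          using C[OF that] le(1)[of t] that by (simp add: True)
      qed
      with assms(2) S True show ?thesis by simp
    next
      case False
      with S have "0 < S" by simp
      define r where "r = real d"
      have r: "2 \<le> r" using d by (simp add: r_def)
      \<comment> \<open>The minimizer of \<open>(1 + S * t / r) ^ d / t\<close> over positive
        \<open>t\<close>.\<close>
      define t where "t = r / (S * (r - 1))"
      have t: "0 < t" using r \<open>0 < S\<close> by (simp add: t_def)
      have "1 + S * t / r = r / (r - 1)"
      proof -
        have "S * t / r = 1 / (r - 1)" using r \<open>0 < S\<close> by (simp add: t_def)
        then show ?thesis using r by (simp add: field_simps)
      qed
      then have "C * t \<le> coeff p 0 * (r / (r - 1)) ^ d"
        using C[OF t] le(1)[of t] t by (simp add: r_def)
      \<comment> \<open>Since \<open>S * t = r / (r - 1)\<close>, one factor of the power turns into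
        \<open>S * t\<close>; the others form \<open>1 / G d\<close>.\<close>
      also have "\<dots> = coeff p 0 * S * t * (r / (r - 1)) ^ (d - 1)"
        using d r \<open>0 < S\<close> by (cases d) (auto simp: t_def)
      finally have "C \<le> coeff p 1 * (r / (r - 1)) ^ (d - 1)"
        using t S(2) by (simp add: mult_ac mult_le_cancel_left_pos)
      then have "((r - 1) / r) ^ (d - 1) * C \<le> ((r - 1) / r) ^ (d - 1) * (coeff p 1 * (r / (r - 1)) ^ (d - 1))"
        using r by (intro mult_left_mono) auto
      also have "\<dots> = coeff p 1"
        using r by (simp add: power_divide)
      finally show ?thesis using d by (simp add: G_def r_def)
    qed
  qed
qed

section \<open>Hurwitz's theorem and the linear coefficient\<close>

text \<open>Continuity is uniform on the compact sets \<open>K \<times> {0..1}\<close>, so the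
  functions at \<open>e = 1 / (n + 1)\<close> converge locally uniformly and Hurwitz's theorem
  applies. It needs a nonconstant limit; a constant one is settled by its value at
  \<open>v\<close>.\<close>

lemma Hurwitz_nonvanishing_limit:
  fixes F :: "complex \<Rightarrow> real \<Rightarrow> complex"
  assumes S: "open S" "connected S"
    and cont: "continuous_on (S \<times> {0..1}) (\<lambda>(w, e). F w e)"
    and hol: "\<And>e. e \<in> {0..1} \<Longrightarrow> (\<lambda>w. F w e) holomorphic_on S"
    and nz: "\<And>w e. w \<in> S \<Longrightarrow> 0 < e \<Longrightarrow> e \<le> 1 \<Longrightarrow> F w e \<noteq> 0"
    and v: "v \<in> S" "F v 0 \<noteq> 0" and w: "w \<in> S"
  shows "F w 0 \<noteq> 0"
proof (cases "(\<lambda>w. F w 0) constant_on S")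
  case True
  with v w show ?thesis by (metis constant_on_def)
next
  case False
  define e where "e n = inverse (real (Suc n))" for n
  have e: "0 < e n" "e n \<le> 1" "e n \<in> {0..1}" for n by (auto simp: e_def field_simps)
  show ?thesis
  proof (rule Hurwitz_no_zeros[OF S, where \<F> = "\<lambda>n w. F w (e n)" and g = "\<lambda>w. F w 0"])
    fix K assume K: "compact K" "K \<subseteq> S"
    have "uniformly_continuous_on (K \<times> {0..1}) (\<lambda>(w, e). F w e)"
      using K by (intro compact_uniformly_continuous continuous_on_subset[OF cont] compact_Times) auto
    then have "uniform_limit K (\<lambda>n w. case (w, e n) of (w, e) \<Rightarrow> F w e) (\<lambda>w. case (w, 0) of (w, e) \<Rightarrow> F w e) sequentially"
      unfolding uniformly_continuous_on_def
    proof (intro uniform_limitI)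
      fix d :: real
      assume "0 < d" and
        *: "\<forall>d>0. \<exists>r>0. \<forall>x\<in>K \<times> {0..1}. \<forall>y\<in>K \<times> {0..1}.
          dist y x < r \<longrightarrow> dist (case y of (w, e) \<Rightarrow> F w e) (case x of (w, e) \<Rightarrow> F w e) < d"
      then obtain r where r: "0 < r" "\<And>x y. x \<in> K \<times> {0..1} \<Longrightarrow> y \<in> K \<times> {0..1} \<Longrightarrow>
          dist y x < r \<Longrightarrow> dist (case y of (w, e) \<Rightarrow> F w e) (case x of (w, e) \<Rightarrow> F w e) < d"
        by blast
      have "e \<longlonglongrightarrow> 0" unfolding e_def by (rule LIMSEQ_inverse_real_of_nat)
      then have "\<forall>\<^sub>F n in sequentially. dist (e n) 0 < r"
        using r(1) by (rule tendstoD)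
      then show "\<forall>\<^sub>F n in sequentially. \<forall>w\<in>K.
          dist (case (w, e n) of (w, e) \<Rightarrow> F w e) (case (w, 0) of (w, e) \<Rightarrow> F w e) < d"
      proof eventually_elim
        case (elim n)
        then show ?case using e(3)[of n] by (intro ballI r(2)) (auto simp: dist_Pair_Pair)
      qed
    qed
    then show "uniform_limit K (\<lambda>n w. F w (e n)) (\<lambda>w. F w 0) sequentially" by simp
  qed (use e hol nz w False in auto)
qed

text \<open>
  If \<open>q\<^sub>0\<close> does not vanish, then \<open>q\<^sub>1 / q\<^sub>0\<close> has nonnegative real part, so \<open>q\<^sub>1 + \<epsilon> q\<^sub>0\<close>
  has no zeros for \<open>\<epsilon> > 0\<close>; if \<open>q\<^sub>0\<close> vanishes identically, \<open>q\<^sub>1\<close> is the limit of \<open>q(\<epsilon>) / \<epsilon>\<close>.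
\<close>

lemma linear_coeff_nonvanishing:
  fixes q :: "complex \<Rightarrow> complex poly"
  assumes S: "open S" "connected S"
    and hol: "\<And>k. (\<lambda>w. coeff (q w) k) holomorphic_on S"
    and deg: "\<And>w. degree (q w) \<le> N"
    and nz: "\<And>w t. w \<in> S \<Longrightarrow> 0 < Re t \<Longrightarrow> poly (q w) t \<noteq> 0"
    and b: "b \<in> S" "coeff (q b) 1 \<noteq> 0" and w: "w \<in> S"
  shows "coeff (q w) 1 \<noteq> 0"
proof -
  have cont: "continuous_on (S \<times> A) (\<lambda>x. coeff (q (fst x)) k)" for k and A :: "real set"
    by (intro continuous_on_compose2[OF holomorphic_on_imp_continuous_on[OF hol[of k]]] continuous_intros) auto
  have poly: "poly (q w) t = (\<Sum>k\<le>N. coeff (q w) k * t ^ k)" for w t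
    unfolding poly_altdef using deg[of w]
    by (intro sum.mono_neutral_left) (auto simp: coeff_eq_0)
  show ?thesis
  proof (cases "\<exists>v\<in>S. coeff (q v) 0 \<noteq> 0")
    case True
    then obtain v where v: "v \<in> S" "coeff (q v) 0 \<noteq> 0" by blast
    \<comment> \<open>Nonvanishing at \<open>v\<close> spreads to all of \<open>S\<close>:
      \<open>coeff (q u) 0\<close> is the limit of the nonzero values \<open>poly (q u) e\<close> as
      \<open>e\<close> decreases to 0.\<close>
    have q0: "coeff (q u) 0 \<noteq> 0" if "u \<in> S" for u
    proof -
      let ?F = "\<lambda>w e. poly (q w) (complex_of_real e)"
      have "?F u 0 \<noteq> 0"
      proof (rule Hurwitz_nonvanishing_limit[OF S, where F = ?F and v = v])
        show "continuous_on (S \<times> {0..1}) (\<lambda>(w, e). poly (q w) (complex_of_real e))"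
          unfolding poly case_prod_unfold by (intro continuous_intros cont)
        show "(\<lambda>w. poly (q w) (complex_of_real e)) holomorphic_on S" for e
          unfolding poly by (intro holomorphic_intros hol)
      qed (use nz v that in \<open>auto simp: poly_0_coeff_0\<close>)
      then show ?thesis by (simp add: poly_0_coeff_0)
    qed
    let ?F = "\<lambda>u e. coeff (q u) 1 + of_real e * coeff (q u) 0"
    have "?F w 0 \<noteq> 0"
    proof (rule Hurwitz_nonvanishing_limit[OF S, where F = ?F and v = b])
      show "continuous_on (S \<times> {0..1}) (\<lambda>(w, e). ?F w e)"
        unfolding case_prod_unfold by (intro continuous_intros cont)
      show "(\<lambda>w. ?F w e) holomorphic_on S" for e
        by (intro holomorphic_intros hol)
      fix u e assume u: "u \<in> S" "0 < (e :: real)"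
      then have "0 \<le> Re (coeff (q u) 1 / coeff (q u) 0)"
        using q0 nz by (intro Re_linear_coeff_quotient_nonneg) auto
      then have "Re (?F u e / coeff (q u) 0) > 0"
        using q0[OF u(1)] u(2) by (simp add: add_divide_distrib)
      then show "?F u e \<noteq> 0" by auto
    qed (use b w in auto)
    then show ?thesis by simp
  next
    case False
    \<comment> \<open>This is \<open>poly (q u) e / e\<close>, written so that it extends to
      \<open>e = 0\<close>.\<close>
    define F where "F u e = (\<Sum>k<N. coeff (q u) (Suc k) * of_real e ^ k)" for u and e :: real
    have F: "poly (q u) (of_real e) = of_real e * F u e" if "u \<in> S" for u e
      unfolding poly F_def using False that
      by (subst sum.atMost_shift) (simp add: sum_distrib_left mult_ac)
    have F0: "F u 0 = coeff (q u) 1" for u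
    proof (cases N)
      case 0
      then show ?thesis using deg[of u] by (simp add: F_def coeff_eq_0)
    next
      case (Suc M)
      then show ?thesis unfolding F_def by (simp add: sum.lessThan_Suc_shift del: sum.lessThan_Suc)
    qed
    have "F w 0 \<noteq> 0"
    proof (rule Hurwitz_nonvanishing_limit[OF S, where F = F and v = b])
      show "continuous_on (S \<times> {0..1}) (\<lambda>(w, e). F w e)"
        unfolding F_def case_prod_unfold by (intro continuous_intros cont)
      show "(\<lambda>w. F w e) holomorphic_on S" for e
        unfolding F_def by (intro holomorphic_intros hol)
      show "F u e \<noteq> 0" if "u \<in> S" "0 < e" for u e
        using nz[OF that(1), of "of_real e"] F[OF that(1), of e] that(2) by auto
    qed (use b w F0 in auto)
    then show ?thesis by (simp add: F0)
  qed
qed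

section \<open>Successive linear coefficients of \<open>p\<close>\<close>

context
  fixes n :: nat and p :: "real mvpoly"
begin

text \<open>
  \<open>tail_deriv i\<close> is \<open>q\<^sub>i\<close>, read off from the monomials of \<open>p\<close> that are linear in each of
  \<open>x\<^bsub>i+1\<^esub>, \<dots>, x\<^sub>n\<close>; \<open>tail_poly i x\<close> is \<open>q\<^bsub>i+1\<^esub>(x\<^sub>1, \<dots>, x\<^sub>i, T)\<close> as a polynomial in \<open>T\<close>.
\<close>

definition tail_mons :: "nat \<Rightarrow> (nat \<Rightarrow>\<^sub>0 nat) set" where
  "tail_mons i = {a \<in> Poly_Mapping.keys p. \<forall>j\<in>{Suc i..n}. Poly_Mapping.lookup a j = 1}"

definition tail_deriv :: "nat \<Rightarrow> (nat \<Rightarrow> 'a) \<Rightarrow> 'a :: real_normed_field" where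
  "tail_deriv i x = (\<Sum>a\<in>tail_mons i. of_real (Poly_Mapping.lookup p a) *
     (\<Prod>j\<in>{1..i}. x j ^ Poly_Mapping.lookup a j))"

definition tail_poly :: "nat \<Rightarrow> (nat \<Rightarrow> 'a) \<Rightarrow> 'a :: real_normed_field poly" where
  "tail_poly i x = (\<Sum>a\<in>tail_mons (Suc i). monom (of_real (Poly_Mapping.lookup p a) *
     (\<Prod>j\<in>{1..i}. x j ^ Poly_Mapping.lookup a j)) (Poly_Mapping.lookup a (Suc i)))"

lemma finite_tail_mons: "finite (tail_mons i)"
  by (simp add: tail_mons_def)

lemma tail_mons_subset_keys: "tail_mons i \<subseteq> Poly_Mapping.keys p"
  by (auto simp: tail_mons_def)

lemma tail_mons_Suc:
  assumes "i < n"
  shows "tail_mons i = {a \<in> tail_mons (Suc i). Poly_Mapping.lookup a (Suc i) = 1}"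
proof -
  have "{Suc i..n} = insert (Suc i) {Suc (Suc i)..n}" using assms by auto
  then show ?thesis by (auto simp: tail_mons_def)
qed

lemma poly_tail_poly: "poly (tail_poly i x) t = tail_deriv (Suc i) (x(Suc i := t))"
proof -
  have "(\<Prod>j\<in>{1..Suc i}. (x(Suc i := t)) j ^ Poly_Mapping.lookup a j) =
      (\<Prod>j\<in>{1..i}. x j ^ Poly_Mapping.lookup a j) * t ^ Poly_Mapping.lookup a (Suc i)" for a
    by (simp add: prod.nat_ivl_Suc')
  then show ?thesis
    by (simp only: tail_poly_def tail_deriv_def poly_sum poly_monom mult.assoc)
qed

lemma coeff_1_tail_poly:
  assumes "i < n"
  shows "coeff (tail_poly i x) 1 = tail_deriv i x"
  unfolding tail_poly_def tail_deriv_def coeff_sum coeff_monom tail_mons_Suc[OF assms]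
  by (rule sum.inter_filter[OF finite_tail_mons, symmetric])

lemma map_poly_tail_poly:
  "map_poly of_real (tail_poly i x) = tail_poly i (\<lambda>j. of_real (x j))"
  by (rule poly_eqI) (simp add: coeff_map_poly tail_poly_def coeff_sum if_distrib cong: if_cong)

lemma mveval_eq_tail_deriv:
  assumes "p \<in> Hom n n"
  shows "mveval p x = tail_deriv n x"
    and "mveval (complexify p) z = tail_deriv n z"
proof -
  have *: "(\<Prod>j\<in>Poly_Mapping.keys a. y j ^ Poly_Mapping.lookup a j) =
      (\<Prod>j\<in>{1..n}. y j ^ Poly_Mapping.lookup a j)"
    if "a \<in> Poly_Mapping.keys p" for a and y :: "nat \<Rightarrow> 'b :: comm_semiring_1"
    using assms that by (intro prod.mono_neutral_left) (auto simp: Hom_def in_keys_iff)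
  \<comment> \<open>The range \<open>{Suc n..n}\<close> is empty, so no exponent is
    constrained.\<close>
  have keys: "tail_mons n = Poly_Mapping.keys p" by (simp add: tail_mons_def)
  show "mveval p x = tail_deriv n x"
    unfolding mveval_def tail_deriv_def keys by (rule sum.cong) (simp_all add: *)
  have "Poly_Mapping.lookup (complexify p) a = of_real (Poly_Mapping.lookup p a)" for a
    by (simp add: Poly_Mapping.map.rep_eq when_def)
  moreover from this have "Poly_Mapping.keys (complexify p) = Poly_Mapping.keys p"
    by (auto simp: in_keys_iff)
  ultimately show "mveval (complexify p) z = tail_deriv n z"
    unfolding mveval_def tail_deriv_def keys by (intro sum.cong) (simp_all add: *)
qed

lemma mixed_partial_eq_tail_deriv:
  assumes "p \<in> Hom n n"
  shows "mixed_partial n (mveval p) (\<lambda>_. 0) = tail_deriv 0 x"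
proof -
  \<comment> \<open>Variables are differentiated termwise from \<open>n\<close> downwards. The
    truncated subtraction at exponent 0 is harmless because the exponent itself is a factor.\<close>
  have step: "foldr partial_deriv [Suc i..<Suc n] (mveval p) = (\<lambda>x :: nat \<Rightarrow> real. \<Sum>a\<in>Poly_Mapping.keys p.
      Poly_Mapping.lookup p a * ((\<Prod>j\<in>{1..i}. x j ^ Poly_Mapping.lookup a j) *
        (\<Prod>j\<in>{Suc i..n}. Poly_Mapping.lookup a j * x j ^ (Poly_Mapping.lookup a j - 1))))"
    (is "_ = ?f i") if "i \<le> n" for i
    using that
  proof (induction rule: inc_induct)
    case base
    show ?case
      by (simp add: fun_eq_iff mveval_eq_tail_deriv(1)[OF assms] tail_deriv_def tail_mons_def)
  next
    case (step i)
    have "[Suc i..<Suc n] = Suc i # [Suc (Suc i)..<Suc n]"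
      using step.hyps by (intro upt_conv_Cons) auto
    then have "foldr partial_deriv [Suc i..<Suc n] (mveval p) = partial_deriv (Suc i) (?f (Suc i))"
      by (simp only: foldr.simps comp_apply step.IH)
    also have "\<dots> = ?f i"
    proof
      fix x :: "nat \<Rightarrow> real"
      have 1: "(\<Prod>j\<in>{1..Suc i}. (x(Suc i := t)) j ^ Poly_Mapping.lookup a j) =
          (\<Prod>j\<in>{1..i}. x j ^ Poly_Mapping.lookup a j) * t ^ Poly_Mapping.lookup a (Suc i)" for a t
        by (simp add: prod.nat_ivl_Suc')
      have 2: "(\<Prod>j\<in>{Suc (Suc i)..n}. Poly_Mapping.lookup a j * (x(Suc i := t)) j ^ (Poly_Mapping.lookup a j - 1)) =
          (\<Prod>j\<in>{Suc (Suc i)..n}. Poly_Mapping.lookup a j * x j ^ (Poly_Mapping.lookup a j - 1))" for a t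
        by (rule prod.cong) auto
      have ins: "{Suc i..n} = insert (Suc i) {Suc (Suc i)..n}" using step by auto
      have "((\<lambda>t. ?f (Suc i) (x(Suc i := t))) has_real_derivative ?f i x) (at (x (Suc i)))"
        unfolding 1 2 ins
        by (auto intro!: derivative_eq_intros sum.cong)
      then show "partial_deriv (Suc i) (?f (Suc i)) x = ?f i x"
        unfolding partial_deriv_def by (rule DERIV_imp_deriv)
    qed
    finally show ?case .
  qed
  \<comment> \<open>Exponent 0 makes the factor vanish, an exponent above 1 makes the power of 0
    vanish, and exponent 1 leaves \<open>0 ^ 0 = 1\<close>.\<close>
  have zero: "(\<Prod>j\<in>{1..n}. real (Poly_Mapping.lookup a j) * 0 ^ (Poly_Mapping.lookup a j - 1)) =
      (if \<forall>j\<in>{1..n}. Poly_Mapping.lookup a j = 1 then 1 else (0 :: real))" for a :: "nat \<Rightarrow>\<^sub>0 nat"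
  proof (cases "\<forall>j\<in>{1..n}. Poly_Mapping.lookup a j = 1")
    case False
    then obtain j where "j \<in> {1..n}" "Poly_Mapping.lookup a j \<noteq> 1" by blast
    then have "j \<in> {1..n}" "real (Poly_Mapping.lookup a j) * 0 ^ (Poly_Mapping.lookup a j - 1) = (0 :: real)"
      by auto
    then have "(\<Prod>j\<in>{1..n}. real (Poly_Mapping.lookup a j) * 0 ^ (Poly_Mapping.lookup a j - 1)) = (0 :: real)"
      by (intro prod_zero) auto
    then show ?thesis using False by simp
  qed simp
  have "mixed_partial n (mveval p) (\<lambda>_. 0) = (\<Sum>a\<in>Poly_Mapping.keys p. Poly_Mapping.lookup p a *
      (\<Prod>j\<in>{1..n}. real (Poly_Mapping.lookup a j) * 0 ^ (Poly_Mapping.lookup a j - 1)))"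
    using step[of 0] by (simp add: mixed_partial_def)
  also have "\<dots> = (\<Sum>a\<in>Poly_Mapping.keys p.
      if \<forall>j\<in>{1..n}. Poly_Mapping.lookup a j = 1 then Poly_Mapping.lookup p a else 0)"
    unfolding zero by (rule sum.cong) auto
  also have "\<dots> = tail_deriv 0 x"
    by (simp add: tail_deriv_def tail_mons_def sum.inter_filter)
  finally show ?thesis .
qed

context
  assumes hom: "p \<in> Hom_plus n n"
begin

lemma coeff_pos: "a \<in> tail_mons i \<Longrightarrow> 0 < Poly_Mapping.lookup p a"
  using hom by (auto simp: Hom_plus_def tail_mons_def in_keys_iff order_less_le)

text \<open>Each of the \<open>n - i\<close> tail variables takes 1 from the total degree
  \<open>n\<close>; hence \<open>tail_deriv i\<close> is homogeneous of degree
  \<open>i\<close>.\<close>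

lemma sum_exponents_tail_mons:
  assumes "i \<le> n" "a \<in> tail_mons i"
  shows "(\<Sum>j\<in>{1..i}. Poly_Mapping.lookup a j) = i"
proof -
  have "{1..n} = {1..i} \<union> {Suc i..n}" using assms(1) by auto
  then have "(\<Sum>j\<in>{1..n}. Poly_Mapping.lookup a j) =
      (\<Sum>j\<in>{1..i}. Poly_Mapping.lookup a j) + (\<Sum>j\<in>{Suc i..n}. Poly_Mapping.lookup a j)"
    by (simp add: sum.union_disjoint)
  also have "(\<Sum>j\<in>{Suc i..n}. Poly_Mapping.lookup a j) = n - i"
    using assms(2) by (simp add: tail_mons_def)
  also have "(\<Sum>j\<in>{1..n}. Poly_Mapping.lookup a j) = n"
    using hom assms(2) by (auto simp: Hom_plus_def Hom_def tail_mons_def)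
  finally show ?thesis using assms(1) by simp
qed

lemma tail_deriv_scale:
  assumes "i \<le> n"
  shows "tail_deriv i (\<lambda>j. u * x j) = u ^ i * tail_deriv i x"
proof -
  have "(\<Prod>j\<in>{1..i}. (u * x j) ^ Poly_Mapping.lookup a j) =
      u ^ i * (\<Prod>j\<in>{1..i}. x j ^ Poly_Mapping.lookup a j)" if "a \<in> tail_mons i" for a
    unfolding power_mult_distrib prod.distrib power_sum[symmetric]
    using sum_exponents_tail_mons[OF assms that] by simp
  then show ?thesis
    by (simp add: tail_deriv_def sum_distrib_left mult_ac)
qed

text \<open>Source of the minimum in the theorem: an exponent is bounded both by the total degree
  \<open>Suc i\<close> and by the degree of \<open>p\<close> in that variable.\<close>

lemma degree_tail_poly:
  assumes "i < n"
  shows "degree (tail_poly i x) \<le> min (Suc i) (deg_var p (Suc i))"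
  unfolding tail_poly_def
proof (intro degree_sum_le finite_tail_mons order.trans[OF degree_monom_le])
  fix a assume a: "a \<in> tail_mons (Suc i)"
  have "Poly_Mapping.lookup a (Suc i) \<le> (\<Sum>j\<in>{1..Suc i}. Poly_Mapping.lookup a j)"
    by (rule member_le_sum) auto
  also have "\<dots> = Suc i" using a assms by (intro sum_exponents_tail_mons) auto
  finally have "Poly_Mapping.lookup a (Suc i) \<le> Suc i" .
  moreover have "Poly_Mapping.lookup a (Suc i) \<le> deg_var p (Suc i)"
    unfolding deg_var_def using a tail_mons_subset_keys by (intro Max_ge) auto
  ultimately show "Poly_Mapping.lookup a (Suc i) \<le> min (Suc i) (deg_var p (Suc i))" by simp
qed

lemma tail_deriv_nonneg: "(\<And>j. j \<in> {1..i} \<Longrightarrow> 0 < x j) \<Longrightarrow> 0 \<le> (tail_deriv i x :: real)"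
  unfolding tail_deriv_def
  by (intro sum_nonneg mult_nonneg_nonneg prod_nonneg) (auto simp: coeff_pos less_imp_le)

section \<open>Stability and real-rootedness\<close>

definition tail_stable :: "nat \<Rightarrow> bool" where
  "tail_stable i \<longleftrightarrow> (\<forall>z :: nat \<Rightarrow> complex. (\<forall>j\<in>{1..i}. 0 < Re (z j)) \<longrightarrow> tail_deriv i z \<noteq> 0)"

text \<open>The complex line \<open>v\<close> through the all-ones point and \<open>z\<close> leaves
  one parameter \<open>w\<close>. At \<open>w = 0\<close> the value is a sum of positive
  coefficients; \<open>linear_coeff_nonvanishing\<close> carries nonvanishing to
  \<open>w = 1\<close>.\<close>

lemma tail_stable_step:
  assumes "i < n" "tail_stable (Suc i)" "tail_mons i \<noteq> {}"
  shows "tail_stable i"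
  unfolding tail_stable_def
proof (intro allI impI)
  fix z :: "nat \<Rightarrow> complex"
  assume z: "\<forall>j\<in>{1..i}. 0 < Re (z j)"
  define v where "v w j = 1 + w * (z j - 1)" for w j
  define S where "S = (\<Inter>j\<in>{1..i}. {w. 0 < Re (v w j)})"
  \<comment> \<open>Each condition cuts out an open half-plane or the whole plane, so
    \<open>S\<close> is open and convex.\<close>
  have half: "{w. 0 < Re (v w j)} = {w. inner (cnj (1 - z j)) w < 1}" for j
    by (auto simp: v_def inner_complex_def algebra_simps)
  have "coeff (tail_poly i (v 1)) 1 \<noteq> 0"
  proof (rule linear_coeff_nonvanishing[where q = "\<lambda>w. tail_poly i (v w)" and b = 0 and S = S])
    show "open S" unfolding S_def half by (intro open_INT ballI open_halfspace_lt) auto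
    show "connected S" unfolding S_def half
      by (intro convex_connected convex_INT convex_halfspace_lt)
    show "(\<lambda>w. coeff (tail_poly i (v w)) k) holomorphic_on S" for k
      unfolding tail_poly_def coeff_sum coeff_monom v_def if_distrib
    proof (rule holomorphic_on_sum)
      show "(\<lambda>w. if Poly_Mapping.lookup a (Suc i) = k
          then of_real (Poly_Mapping.lookup p a) * (\<Prod>j\<in>{1..i}. (1 + w * (z j - 1)) ^ Poly_Mapping.lookup a j)
          else 0) holomorphic_on S" for a
        by (cases "Poly_Mapping.lookup a (Suc i) = k") (auto intro!: holomorphic_intros)
    qed
    show "degree (tail_poly i (v w)) \<le> min (Suc i) (deg_var p (Suc i))" for w
      by (rule degree_tail_poly[OF assms(1)])
    show "poly (tail_poly i (v w)) t \<noteq> 0" if "w \<in> S" "0 < Re t" for w t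
      unfolding poly_tail_poly using assms(2) that by (auto simp: tail_stable_def S_def)
    show "0 \<in> S" "1 \<in> S" using z by (auto simp: S_def v_def)
    have "tail_deriv i (v 0) = of_real (\<Sum>a\<in>tail_mons i. Poly_Mapping.lookup p a)"
      by (simp add: tail_deriv_def v_def)
    moreover have "0 < (\<Sum>a\<in>tail_mons i. Poly_Mapping.lookup p a)"
      using assms(3) finite_tail_mons coeff_pos by (intro sum_pos) auto
    ultimately show "coeff (tail_poly i (v 0)) 1 \<noteq> 0"
      using coeff_1_tail_poly[OF assms(1), of "v 0"] by (metis of_real_eq_0_iff less_irrefl)
  qed
  moreover have "v 1 = z" by (simp add: v_def fun_eq_iff)
  ultimately show "tail_deriv i z \<noteq> 0" using coeff_1_tail_poly[OF assms(1), of z] by simp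
qed

text \<open>In the descent from \<open>n\<close>, emptiness persists because
  \<open>tail_mons i\<close> is contained in \<open>tail_mons (Suc i)\<close>.\<close>

lemma tail_stable_or_empty:
  assumes "tail_stable n" "i \<le> n"
  shows "tail_mons i = {} \<or> tail_stable i"
  using assms(2)
proof (induction rule: inc_induct)
  case base
  then show ?case using assms(1) by simp
next
  case (step i)
  then show ?case using tail_stable_step[of i] tail_mons_Suc[of i] by auto
qed

text \<open>By homogeneity, multiplying all coordinates of a zero by one complex number gives
  another zero. For any other \<open>z\<close>, a suitable multiple lies where stability forbids
  zeros.\<close>

lemma tail_poly_root_nonpos:
  assumes "i < n" "tail_stable (Suc i)" "\<And>j. j \<in> {1..i} \<Longrightarrow> 0 < x j"
    and root: "poly (map_poly complex_of_real (tail_poly i x)) z = 0"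
  shows "z \<in> \<real>\<^sub>\<le>\<^sub>0"
proof (rule ccontr)
  assume z: "z \<notin> \<real>\<^sub>\<le>\<^sub>0"
  define y where "y = (\<lambda>j. complex_of_real (x j))(Suc i := z)"
  \<comment> \<open>Multiplication by \<open>u\<close> moves both \<open>z\<close> and the positive reals into the right half-plane.\<close>
  define u where "u = cnj (csqrt z)"
  \<comment> \<open>A purely imaginary square root would make \<open>z\<close> a nonpositive
    real.\<close>
  have "Re (csqrt z) \<noteq> 0"
  proof
    assume "Re (csqrt z) = 0"
    then have "csqrt z ^ 2 = of_real (- (Im (csqrt z) ^ 2))"
      by (simp add: complex_eq_iff power2_eq_square)
    then have "z = of_real (- (Im (csqrt z) ^ 2))" by simp
    then show False using z by (metis neg_le_0_iff_le nonpos_Reals_of_real_iff zero_le_power2)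
  qed
  moreover have "0 \<le> Re (csqrt z)" using csqrt_principal[of z] by auto
  ultimately have "0 < Re (csqrt z)" by simp
  then have u: "0 < Re u" by (simp add: u_def)
  \<comment> \<open>With \<open>s = csqrt z\<close>, the product is \<open>cnj s * s ^ 2\<close>, a
    positive multiple of \<open>s\<close>.\<close>
  have "u * z = u * csqrt z ^ 2" by simp
  also have "\<dots> = of_real (cmod (csqrt z) ^ 2) * csqrt z"
    unfolding u_def complex_norm_square by (simp only: power2_eq_square mult_ac)
  finally have "u * z = of_real (cmod (csqrt z) ^ 2) * csqrt z" .
  moreover have "z \<noteq> 0" using z by auto
  ultimately have "0 < Re (u * z)"
    using \<open>0 < Re (csqrt z)\<close> by (simp del: csqrt.simps)
  with u assms(3) have "\<forall>j\<in>{1..Suc i}. 0 < Re (u * y j)"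
    by (auto simp: y_def le_Suc_eq)
  then have "tail_deriv (Suc i) (\<lambda>j. u * y j) \<noteq> 0"
    using assms(2) by (simp add: tail_stable_def)
  moreover have "tail_deriv (Suc i) y = 0"
    using root unfolding map_poly_tail_poly poly_tail_poly y_def .
  ultimately show False
    using tail_deriv_scale[of "Suc i" u y] assms(1) by simp
qed

section \<open>Descent of the capacity\<close>

text \<open>It links \<open>Cap n p\<close> at \<open>i = n\<close> to the mixed partial at
  \<open>i = 0\<close>, where the infimum is that of a constant.\<close>

definition tail_cap :: "nat \<Rightarrow> real" where
  "tail_cap i = (INF x\<in>{x. \<forall>j\<in>{1..i}. 0 < x j}. tail_deriv i x / (\<Prod>j\<in>{1..i}. x j))"

lemma tail_cap_le: "(\<And>j. j \<in> {1..i} \<Longrightarrow> 0 < x j) \<Longrightarrow> tail_cap i * (\<Prod>j\<in>{1..i}. x j) \<le> tail_deriv i x"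
  and tail_cap_ge: "(\<And>x. (\<And>j. j \<in> {1..i} \<Longrightarrow> 0 < x j) \<Longrightarrow>
      c * (\<Prod>j\<in>{1..i}. x j) \<le> tail_deriv i x) \<Longrightarrow> c \<le> tail_cap i"
proof -
  let ?A = "{x :: nat \<Rightarrow> real. \<forall>j\<in>{1..i}. 0 < x j}"
  have pos: "0 < (\<Prod>j\<in>{1..i}. x j)" if "x \<in> ?A" for x using that by (intro prod_pos) auto
  have bdd: "bdd_below ((\<lambda>x. tail_deriv i x / (\<Prod>j\<in>{1..i}. x j)) ` ?A)"
    using pos by (intro bdd_belowI2[where m = 0] divide_nonneg_pos tail_deriv_nonneg) auto
  show "tail_cap i * (\<Prod>j\<in>{1..i}. x j) \<le> tail_deriv i x" if "\<And>j. j \<in> {1..i} \<Longrightarrow> 0 < x j"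
  proof -
    have "tail_cap i \<le> tail_deriv i x / (\<Prod>j\<in>{1..i}. x j)"
      unfolding tail_cap_def using bdd that by (intro cINF_lower) auto
    then show ?thesis using pos[of x] that by (simp add: le_divide_eq)
  qed
  show "c \<le> tail_cap i"
    if "\<And>x. (\<And>j. j \<in> {1..i} \<Longrightarrow> 0 < x j) \<Longrightarrow> c * (\<Prod>j\<in>{1..i}. x j) \<le> tail_deriv i x"
    unfolding tail_cap_def
  proof (rule cINF_greatest)
    show "?A \<noteq> {}" by (auto intro!: exI[of _ "\<lambda>_. 1"])
    fix x assume x: "x \<in> ?A"
    then have "c * (\<Prod>j\<in>{1..i}. x j) \<le> tail_deriv i x" by (intro that) blast
    then show "c \<le> tail_deriv i x / (\<Prod>j\<in>{1..i}. x j)"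
      using pos[OF x] by (simp add: le_divide_eq)
  qed
qed

lemma tail_cap_nonneg: "0 \<le> tail_cap i"
  by (rule tail_cap_ge) (simp only: mult_zero_left tail_deriv_nonneg)

lemma tail_cap_0: "tail_cap 0 = tail_deriv 0 x"
  by (simp add: tail_cap_def tail_deriv_def)

text \<open>With positive \<open>x 1, ..., x i\<close> frozen, the capacity bounds the polynomial in
  the next variable below by a multiple of \<open>t\<close>; \<open>linear_coeff_ge_G\<close> then
  bounds its linear coefficient \<open>tail_deriv i x\<close>.\<close>

lemma tail_cap_step:
  assumes "i < n" "tail_mons (Suc i) = {} \<or> tail_stable (Suc i)"
  shows "G (min (Suc i) (deg_var p (Suc i))) * tail_cap (Suc i) \<le> tail_cap i"
proof (cases "tail_mons (Suc i) = {}")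
  case True
  then have "tail_cap (Suc i) \<le> 0"
    using tail_cap_le[of "Suc i" "\<lambda>_. 1"] by (simp add: tail_deriv_def)
  then have "tail_cap (Suc i) = 0" using tail_cap_nonneg[of "Suc i"] by linarith
  then show ?thesis by (simp add: tail_cap_nonneg)
next
  case False
  with assms(2) have stable: "tail_stable (Suc i)" by simp
  show ?thesis
  proof (rule tail_cap_ge)
    fix x :: "nat \<Rightarrow> real" assume x: "\<And>j. j \<in> {1..i} \<Longrightarrow> 0 < x j"
    let ?P = "\<Prod>j\<in>{1..i}. x j"
    have "G (min (Suc i) (deg_var p (Suc i))) * (tail_cap (Suc i) * ?P) \<le> coeff (tail_poly i x) 1"
    proof (rule linear_coeff_ge_G)
      show "degree (tail_poly i x) \<le> min (Suc i) (deg_var p (Suc i))"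
        by (rule degree_tail_poly[OF assms(1)])
      show "0 \<le> tail_cap (Suc i) * ?P"
        using x by (intro mult_nonneg_nonneg tail_cap_nonneg prod_nonneg) (auto intro: less_imp_le)
      show "0 \<le> coeff (tail_poly i x) 0"
        unfolding tail_poly_def coeff_sum coeff_monom using x
        by (intro sum_nonneg) (auto intro!: mult_nonneg_nonneg prod_nonneg simp: coeff_pos less_imp_le)
      show "tail_cap (Suc i) * ?P * t \<le> poly (tail_poly i x) t" if "0 < t" for t
        using tail_cap_le[of "Suc i" "x(Suc i := t)"] x that
        by (simp add: poly_tail_poly prod.nat_ivl_Suc' mult_ac)
      show "z \<in> \<real>\<^sub>\<le>\<^sub>0" if "poly (map_poly of_real (tail_poly i x)) z = 0" for z :: complex
        using tail_poly_root_nonpos[OF assms(1) stable x that] .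
    qed
    then show "G (min (Suc i) (deg_var p (Suc i))) * tail_cap (Suc i) * ?P \<le> tail_deriv i x"
      using coeff_1_tail_poly[OF assms(1), of x] by (simp add: mult.assoc)
  qed
qed

lemma prod_G_tail_cap_le:
  assumes "tail_stable n" "i \<le> n"
  shows "(\<Prod>j\<in>{1..i}. G (min j (deg_var p j))) * tail_cap i \<le> tail_cap 0"
  using assms(2)
proof (induction i)
  case (Suc i)
  let ?P = "\<Prod>j\<in>{1..i}. G (min j (deg_var p j))"
  have "?P * (G (min (Suc i) (deg_var p (Suc i))) * tail_cap (Suc i)) \<le> ?P * tail_cap i"
    using Suc.prems tail_stable_or_empty[OF assms(1)]
    by (intro mult_left_mono tail_cap_step prod_nonneg) (auto simp: G_nonneg)
  also have "\<dots> \<le> tail_cap 0" using Suc by simp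
  finally show ?case by (simp add: prod.nat_ivl_Suc' mult_ac)
qed simp

end

end

theorem theorem2p4:
  fixes n :: nat and p :: "real mvpoly"
  assumes "n \<ge> 1"
    and "p \<in> Hom_plus n n"
    and "H_stable n n (complexify p)"
  shows "mixed_partial n (mveval p) (\<lambda>_. 0)
           \<ge> (\<Prod>i\<in>{2..n}. G (min i (deg_var p i))) * Cap n p"
proof -
  have hom: "p \<in> Hom n n" using assms(2) by (simp add: Hom_plus_def)
  have "tail_stable n p n"
    using assms(3) by (simp add: tail_stable_def[OF assms(2)] H_stable_def mveval_eq_tail_deriv[OF hom])
  then have "(\<Prod>i\<in>{1..n}. G (min i (deg_var p i))) * tail_cap n p n \<le> tail_cap n p 0"
    using prod_G_tail_cap_le[OF assms(2)] by blast
  \<comment> \<open>At \<open>i = 1\<close> the minimum is at most 1, where \<open>G\<close> equals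
    1.\<close>
  also have "(\<Prod>i\<in>{1..n}. G (min i (deg_var p i))) = (\<Prod>i\<in>{2..n}. G (min i (deg_var p i)))"
    by (rule prod.mono_neutral_right) (auto simp: G_def)
  also have "tail_cap n p n = Cap n p"
    by (simp add: tail_cap_def[OF assms(2)] Cap_def mveval_eq_tail_deriv[OF hom])
  also have "tail_cap n p 0 = mixed_partial n (mveval p) (\<lambda>_. 0)"
    using tail_cap_0[OF assms(2)] mixed_partial_eq_tail_deriv[OF hom] by metis
  finally show ?thesis .
qed

end
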